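(* Let $G$ be the group of Construction B or Construction C in the context, and assume $1<\deg(S_1)<q/p$. Then the Thompson subgroup of $G$ is $J(G)=\{\mathfrak{g}_{a,b,0}:a,b\in\mathbb{F}_q,\ \theta_{a,b,0}=1\}$, which has order $q^2$ in the case of Construction B and $q^2/p$ in the case of Construction C.
   Context: The Thompson subgroup $J(G)$ of a finite $p$-group is generated by its abelian subgroups of maximal order. $q=p^{pl}$, $p$ odd prime, $l\ge1$, $g\in\mathrm{Aut}(\mathbb{F}_q)$, $g(x)=x^{p^l}$, $\mathrm{tr}=\mathrm{tr}_{\mathbb{F}_q/\mathbb{F}_p}$. $E(a,b,c,t)$ is the matrix with rows $(1,0,0,0),(-c,1,0,0),(b-ct,t,1,0),(a,b,c,1)$; pairs $(A,\sigma)$ multiply by $(A_1,\sigma_1)\circ(A_2,\sigma_2)=(A_1^{\sigma_2}A_2,\sigma_1\sigma_2)$; $\mathfrak{g}_{a,b,c}=(E(a,b,c,T(a,b,c)),\theta_{a,b,c})$, $G=\{\mathfrak{g}_{a,b,c}:a,b,c\in\mathbb{F}_q\}$. Construction B: $S_1$ a reduced linearized polynomial ($\sum_{i=0}^{pl-1}s_iX^{p^i}$) with coefficients in $\mathbb{F}_{p^l}$; $\mu_C\in\mathbb{F}_{p^l}^*$; $\theta_{a,b,c}=g^{\mathrm{tr}(\mu_Cc)}$, $T(a,b,c)=S_1(c)$. Construction C: $\mu_B\in\mathbb{F}_{p^l}^*$; $s_i\in\mathbb{F}_{p^l}$ with $\mu_Bs_i-s_{pl-i}^{p^i}\mu_B^{p^i}=0$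 for $1\le i\le pl-1$; $S_1=\sum_{i=0}^{pl-1}s_iX^{p^i}$, $Q(x)=-\mathrm{tr}(\mu_BxS_1(x))$; $\theta_{a,b,c}=g^{\frac12Q(c)+\mathrm{tr}(\mu_Bb)}$, $T(a,b,c)=S_1(c)$. *)

theory Defs
  imports
    "HOL-Analysis.Cartesian_Space"
    "HOL-Computational_Algebra.Polynomial"
    "HOL-Computational_Algebra.Primes"
    "HOL-Algebra.Generated_Groups"
begin

text \<open>
  The field \<open>\<bbbF>\<^sub>q\<close> with \<open>q = p\<^bsup>pl\<^esup>\<close> is an arbitrary type \<open>'a :: {field, finite}\<close> with
  \<open>CARD('a) = p ^ (p * l)\<close>.
\<close>

definition abelian_subgroup :: "('b, 'c) monoid_scheme \<Rightarrow> 'b set \<Rightarrow> bool" where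
  "abelian_subgroup G A \<longleftrightarrow> subgroup A G \<and> comm_group (G\<lparr>carrier := A\<rparr>)"

definition max_order_abelian_subgroups :: "('b, 'c) monoid_scheme \<Rightarrow> 'b set set" where
  "max_order_abelian_subgroups G =
     {A. abelian_subgroup G A \<and> (\<forall>B. abelian_subgroup G B \<longrightarrow> card B \<le> card A)}"

definition thompson_subgroup :: "('b, 'c) monoid_scheme \<Rightarrow> 'b set" where
  "thompson_subgroup G = generate G (\<Union> (max_order_abelian_subgroups G))"

text \<open>The copy of \<open>\<bbbF>\<^bsub>p^l\<^esub>\<close> inside \<open>\<bbbF>\<^sub>q\<close>.\<close>

definition Fpl :: "nat \<Rightarrow> nat \<Rightarrow> 'a::field set" where
  "Fpl p l = {x. x ^ (p ^ l) = x}"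

definition frob :: "nat \<Rightarrow> nat \<Rightarrow> 'a::field \<Rightarrow> 'a" where
  "frob p l x = x ^ (p ^ l)"

text \<open>The absolute trace of \<open>\<bbbF>\<^sub>q\<close>, as an element of the prime field inside \<open>\<bbbF>\<^sub>q\<close>.\<close>

definition tr :: "nat \<Rightarrow> nat \<Rightarrow> 'a::field \<Rightarrow> 'a" where
  "tr p l x = (\<Sum>i<p * l. x ^ (p ^ i))"

text \<open>
  \<open>g\<close> has order \<open>p\<close>, so \<open>g\<^sup>e\<close> makes sense for \<open>e\<close> in the prime field; the exponent is
  lifted to its representative in \<open>{0..<p}\<close>.
\<close>

definition frob_pow :: "nat \<Rightarrow> nat \<Rightarrow> 'a::field \<Rightarrow> 'a \<Rightarrow> 'a" where
  "frob_pow p l e = (frob p l ^^ (LEAST n. of_nat n = e))"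

definition lin_poly :: "nat \<Rightarrow> nat \<Rightarrow> (nat \<Rightarrow> 'a::field) \<Rightarrow> 'a poly" where
  "lin_poly p l s = (\<Sum>i<p * l. monom (s i) (p ^ i))"

definition E :: "'a::field \<Rightarrow> 'a \<Rightarrow> 'a \<Rightarrow> 'a \<Rightarrow> 'a^4^4" where
  "E a b c t = vector [vector [1, 0, 0, 0],
                       vector [-c, 1, 0, 0],
                       vector [b - c * t, t, 1, 0],
                       vector [a, b, c, 1]]"

type_synonym 'a sl_pair = "('a^4^4) \<times> ('a \<Rightarrow> 'a)"

text \<open>
  Automorphisms act on the right (exponent notation), so the product \<open>\<sigma>\<^sub>1\<sigma>\<^sub>2\<close> applies
  \<open>\<sigma>\<^sub>1\<close> first; this is what makes the multiplication of pairs associative.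
\<close>

fun pair_mult :: "'a::field sl_pair \<Rightarrow> 'a sl_pair \<Rightarrow> 'a sl_pair" where
  "pair_mult (A1, \<sigma>1) (A2, \<sigma>2) = (map_matrix \<sigma>2 A1 ** A2, \<sigma>2 \<circ> \<sigma>1)"

definition gelem ::
  "('a::field \<Rightarrow> 'a \<Rightarrow> 'a \<Rightarrow> 'a) \<Rightarrow> ('a \<Rightarrow> 'a \<Rightarrow> 'a \<Rightarrow> 'a \<Rightarrow> 'a) \<Rightarrow>
   'a \<Rightarrow> 'a \<Rightarrow> 'a \<Rightarrow> 'a sl_pair" where
  "gelem T \<theta> a b c = (E a b c (T a b c), \<theta> a b c)"

definition ggroup ::
  "('a::field \<Rightarrow> 'a \<Rightarrow> 'a \<Rightarrow> 'a) \<Rightarrow> ('a \<Rightarrow> 'a \<Rightarrow> 'a \<Rightarrow> 'a \<Rightarrow> 'a) \<Rightarrow>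
   'a sl_pair monoid" where
  "ggroup T \<theta> = \<lparr>carrier = {gelem T \<theta> a b c | a b c. True}, mult = pair_mult, one = (mat 1, id)\<rparr>"

definition T_S1 :: "nat \<Rightarrow> nat \<Rightarrow> (nat \<Rightarrow> 'a::field) \<Rightarrow> 'a \<Rightarrow> 'a \<Rightarrow> 'a \<Rightarrow> 'a" where
  "T_S1 p l s a b c = poly (lin_poly p l s) c"

definition theta_B :: "nat \<Rightarrow> nat \<Rightarrow> 'a::field \<Rightarrow> 'a \<Rightarrow> 'a \<Rightarrow> 'a \<Rightarrow> 'a \<Rightarrow> 'a" where
  "theta_B p l \<mu> a b c = frob_pow p l (tr p l (\<mu> * c))"

definition Q_C :: "nat \<Rightarrow> nat \<Rightarrow> 'a::field \<Rightarrow> (nat \<Rightarrow> 'a) \<Rightarrow> 'a \<Rightarrow> 'a" where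
  "Q_C p l \<mu> s x = - tr p l (\<mu> * x * poly (lin_poly p l s) x)"

definition theta_C :: "nat \<Rightarrow> nat \<Rightarrow> 'a::field \<Rightarrow> (nat \<Rightarrow> 'a) \<Rightarrow> 'a \<Rightarrow> 'a \<Rightarrow> 'a \<Rightarrow> 'a \<Rightarrow> 'a" where
  "theta_C p l \<mu> s a b c = frob_pow p l (1 / 2 * Q_C p l \<mu> s c + tr p l (\<mu> * b))"

definition group_B :: "nat \<Rightarrow> nat \<Rightarrow> 'a::field \<Rightarrow> (nat \<Rightarrow> 'a) \<Rightarrow> 'a sl_pair monoid" where
  "group_B p l \<mu> s = ggroup (T_S1 p l s) (theta_B p l \<mu>)"

definition group_C :: "nat \<Rightarrow> nat \<Rightarrow> 'a::field \<Rightarrow> (nat \<Rightarrow> 'a) \<Rightarrow> 'a sl_pair monoid" where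
  "group_C p l \<mu> s = ggroup (T_S1 p l s) (theta_C p l \<mu> s)"

definition elem_B ::
  "nat \<Rightarrow> nat \<Rightarrow> 'a::field \<Rightarrow> (nat \<Rightarrow> 'a) \<Rightarrow> 'a \<Rightarrow> 'a \<Rightarrow> 'a \<Rightarrow> 'a sl_pair" where
  "elem_B p l \<mu> s = gelem (T_S1 p l s) (theta_B p l \<mu>)"

definition elem_C ::
  "nat \<Rightarrow> nat \<Rightarrow> 'a::field \<Rightarrow> (nat \<Rightarrow> 'a) \<Rightarrow> 'a \<Rightarrow> 'a \<Rightarrow> 'a \<Rightarrow> 'a sl_pair" where
  "elem_C p l \<mu> s = gelem (T_S1 p l s) (theta_C p l \<mu> s)"

lemma E_nth:
  "E a b c t $ 1 $ 1 = 1" "E a b c t $ 1 $ 2 = 0" "E a b c t $ 1 $ 3 = 0" "E a b c t $ 1 $ 4 = 0"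
  "E a b c t $ 2 $ 1 = -c" "E a b c t $ 2 $ 2 = 1" "E a b c t $ 2 $ 3 = 0" "E a b c t $ 2 $ 4 = 0"
  "E a b c t $ 3 $ 1 = b - c * t" "E a b c t $ 3 $ 2 = t" "E a b c t $ 3 $ 3 = 1" "E a b c t $ 3 $ 4 = 0"
  "E a b c t $ 4 $ 1 = a" "E a b c t $ 4 $ 2 = b" "E a b c t $ 4 $ 3 = c" "E a b c t $ 4 $ 4 = 1"
  by (simp_all add: E_def vector_def)

end

theory Submission
  imports Defs "HOL-Number_Theory.Cong"
begin

text \<open>
  Let \<open>H\<close> be the set of elements \<open>(a, b, 0)\<close> with trivial automorphism part. It is an abelian subgroup
  of order at least \<open>q\<^sup>2/p\<close>, and every abelian subgroup \<open>A\<close> not contained in \<open>H\<close> has order less than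
  \<open>q\<^sup>2/p\<close>, so that \<open>H\<close> is the only abelian subgroup of maximal order.

  For the bound on \<open>A\<close>, let \<open>A\<^sub>0\<close> be its subgroup of elements with trivial automorphism part. Two
  commuting elements of \<open>A\<^sub>0\<close> satisfy \<open>c\<^sub>1 S\<^sub>1(c) = c S\<^sub>1(c\<^sub>1)\<close>; if some \<open>c\<^sub>1\<close> is nonzero, the values of \<open>c\<close> on
  \<open>A\<^sub>0\<close> are roots of \<open>S\<^sub>1 - (S\<^sub>1(c\<^sub>1)/c\<^sub>1) X\<close>, whose degree is \<open>deg S\<^sub>1 < q/p\<close>. If \<open>A = A\<^sub>0\<close>, an element of
  \<open>A\<close> with \<open>c\<^sub>1 \<noteq> 0\<close> forces \<open>b = 0\<close> on the elements with \<open>c = 0\<close>, hence \<open>|A| \<le> q deg S\<^sub>1\<close>.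
  Otherwise \<open>A\<close> has an element with automorphism \<open>\<sigma> \<noteq> 1\<close>, and then \<open>\<sigma> b = b\<close> and \<open>\<sigma> a = a + 2 c\<^sub>1 b\<close>
  for the elements \<open>(a, b, 0)\<close> of \<open>A\<^sub>0\<close>. As \<open>\<sigma>\<close> has fixed field \<open>\<bbbF>\<^bsub>p^l\<^esub>\<close>, there are at most \<open>p\<^bsup>2l\<^esup>\<close> of
  them, hence \<open>|A| \<le> p\<^bsup>2l+1\<^esup> deg S\<^sub>1\<close>.
\<close>

section \<open>Counting by fibres, finite fields and the matrices \<open>E\<close>\<close>

text \<open>Measuring each fibre by \<open>d\<close> from a chosen base point embeds
  \<open>A\<close> into the product of the image and \<open>K\<close>. It serves both for additive
  differences and for quotients in the group.\<close>

lemma card_le_image_times_fibre: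
  assumes "finite A" "finite K"
    and "\<And>x y. x \<in> A \<Longrightarrow> y \<in> A \<Longrightarrow> f x = f y \<Longrightarrow> d x y \<in> K"
    and inj: "\<And>x y z. x \<in> A \<Longrightarrow> y \<in> A \<Longrightarrow> z \<in> A \<Longrightarrow> f y = f x \<Longrightarrow> f z = f x \<Longrightarrow>
               d x y = d x z \<Longrightarrow> y = z"
  shows "card A \<le> card (f ` A) * card K"
proof -
  define r where "r = inv_into A f"
  have r: "r (f y) \<in> A" "f (r (f y)) = f y" if "y \<in> A" for y
    using that by (auto simp: r_def inv_into_into f_inv_into_f)
  have "card A \<le> card (f ` A \<times> K)"
  proof (rule card_inj_on_le)
    show "inj_on (\<lambda>y. (f y, d (r (f y)) y)) A"
      by (rule inj_onI) (metis inj prod.inject r)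
    show "(\<lambda>y. (f y, d (r (f y)) y)) ` A \<subseteq> f ` A \<times> K"
      using r assms(3) by auto
  qed (use assms in auto)
  then show ?thesis
    by (simp add: card_cartesian_product)
qed

text \<open>Multiplication by a nonzero \<open>x\<close> permutes the nonzero elements, so their
  product absorbs the factor \<open>x ^ (CARD('a) - 1)\<close>.\<close>

lemma field_power_CARD:
  fixes x :: "'a::{field, finite}"
  shows "x ^ CARD('a) = x"
proof (cases "x = 0")
  case False
  define P where "P = (\<Prod>y\<in>-{0::'a}. y)"
  have "P = (\<Prod>y\<in>-{0}. x * y)"
    unfolding P_def
    by (rule prod.reindex_bij_witness[of _ "\<lambda>y. x * y" "\<lambda>y. y / x"]) (use False in auto)
  also have "\<dots> = x ^ (CARD('a) - 1) * P"
    by (simp add: prod.distrib P_def Compl_eq_Diff_UNIV)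
  finally have "x ^ (CARD('a) - 1) = 1"
    by (simp add: P_def)
  then show ?thesis
    by (metis finite_UNIV_card_ge_0 finite_class.finite_UNIV mult.right_neutral power_eq_if not_gr_zero)
qed (simp add: finite_UNIV_card_ge_0)

lemma card_power_eq_self_le:
  fixes n :: nat
  assumes "n > 1"
  shows "card {x::'a::field. x ^ n = x} \<le> n"
proof -
  define P :: "'a poly" where "P = monom 1 n - monom 1 1"
  have "coeff P n = 1"
    using assms by (simp add: P_def)
  then have "P \<noteq> 0"
    by force
  then have "card {x. poly P x = 0} \<le> degree P"
    by (rule card_poly_roots_bound)
  also have "degree P \<le> n"
    unfolding P_def by (rule degree_diff_le) (use assms in \<open>auto simp: degree_monom_eq\<close>)
  finally show ?thesis
    by (simp add: P_def poly_monom)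
qed

text \<open>The entry \<open>b - c * t\<close> is what keeps the shape of \<open>E\<close> under
  multiplication. Here \<open>t\<close> is arbitrary; \<open>el_mult\<close> specialises it to
  \<open>S c\<close>.\<close>

lemma E_mult:
  fixes \<sigma> :: "'a::field \<Rightarrow> 'a"
  assumes "\<sigma> 0 = 0" "\<sigma> 1 = 1" "\<And>x y. \<sigma> (x + y) = \<sigma> x + \<sigma> y" "\<And>x y. \<sigma> (x * y) = \<sigma> x * \<sigma> y"
  shows "map_matrix \<sigma> (E a1 b1 c1 t1) ** E a2 b2 c2 t2 =
    E (\<sigma> a1 + a2 - \<sigma> b1 * c2 + \<sigma> c1 * b2 - \<sigma> c1 * c2 * t2) (\<sigma> b1 + b2 + \<sigma> c1 * t2)
      (\<sigma> c1 + c2) (\<sigma> t1 + t2)"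
proof -
  have minus: "\<sigma> (- x) = - \<sigma> x" for x
    using assms(3)[of x "- x"] assms(1) by (simp add: eq_neg_iff_add_eq_0 add.commute)
  have diff: "\<sigma> (x - y) = \<sigma> x - \<sigma> y" for x y
    using assms(3)[of x "- y"] minus by simp
  show ?thesis
    unfolding vec_eq_iff forall_4
    by (simp add: matrix_matrix_mult_def sum_4 E_nth assms minus diff algebra_simps)
qed

lemma E_eq_iff: "E a b c t = E a' b' c' t' \<longleftrightarrow> a = a' \<and> b = b' \<and> c = c' \<and> t = t'"
  by (metis E_nth)

lemma E_0: "E 0 0 0 0 = mat 1"
  unfolding vec_eq_iff forall_4 by (simp add: E_nth mat_def)

section \<open>Frobenius, trace and linearized polynomials\<close>

locale frob_field =
  fixes p l :: nat and s :: "nat \<Rightarrow> 'a::{field, finite}"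
  assumes p: "prime p" "odd p" and l: "l \<ge> 1"
    and CARD_eq: "CARD('a) = p ^ (p * l)"
    and s_Fpl: "\<forall>i<p * l. s i \<in> Fpl p l"
begin

abbreviation S :: "'a \<Rightarrow> 'a" where
  "S \<equiv> poly (lin_poly p l s)"

lemma p_ge_3: "p \<ge> 3"
  using prime_ge_2_nat[OF p(1)] p(2) by (cases "p = 2") auto

text \<open>Summing all field elements before and after translation by 1 shows that \<open>q\<close>
  vanishes in the field, so the characteristic is a prime dividing a power of
  \<open>p\<close>.\<close>

lemma CHAR_eq: "CHAR('a) = p"
proof -
  have "CHAR('a) > 0"
    by (rule finite_imp_CHAR_pos) simp
  then have pr: "prime CHAR('a)"
    by (rule prime_CHAR_semidom)
  have "CHAR('a) dvd p ^ (p * l)"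
  proof -
    have "(\<Sum>y\<in>UNIV. y + 1 :: 'a) = (\<Sum>y\<in>UNIV. y)"
      by (rule sum.reindex_bij_witness[of _ "\<lambda>y. y - 1" "\<lambda>y. y + 1"]) auto
    then have "of_nat CARD('a) = (0::'a)"
      by (simp add: sum.distrib)
    then show ?thesis
      unfolding of_nat_eq_0_iff_char_dvd CARD_eq .
  qed
  then have "CHAR('a) dvd p"
    using pr prime_dvd_power by blast
  then show ?thesis
    using pr p(1) primes_dvd_imp_eq by blast
qed

lemma power_p_add: "(x + y :: 'a) ^ p ^ i = x ^ p ^ i + y ^ p ^ i"
  by (rule freshmans_dream') (use p CHAR_eq in auto)

lemma power_p_sum: "(sum f A :: 'a) ^ p ^ i = (\<Sum>j\<in>A. f j ^ p ^ i)"
  by (rule freshmans_dream_sum') (use p CHAR_eq in auto)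

lemma power_p_pl: "(x::'a) ^ p ^ (p * l) = x"
  using field_power_CARD[of x] by (simp add: CARD_eq)

lemma of_nat_eq_iff_mod: "(of_nat m :: 'a) = of_nat n \<longleftrightarrow> m mod p = n mod p"
  using of_nat_eq_iff_cong_CHAR[where 'a='a] by (simp add: CHAR_eq cong_def)

lemma two_nonzero: "(2::'a) \<noteq> 0"
  using of_nat_eq_iff_mod[of 2 0] p_ge_3 by simp

lemma of_nat_power_p: "(of_nat n :: 'a) ^ p = of_nat n"
proof (induction n)
  case (Suc n)
  then show ?case
    using power_p_add[of 1 "of_nat n" 1] by simp
qed (use p_ge_3 in simp)

text \<open>The images of the numbers below \<open>p\<close> are \<open>p\<close> distinct roots of
  \<open>X ^ p - X\<close>, which has no more than \<open>p\<close>.\<close>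

lemma prime_field_iff: "(x::'a) ^ p = x \<longleftrightarrow> x \<in> of_nat ` {..<p}"
proof -
  have "card {x::'a. x ^ p = x} \<le> p"
    using p_ge_3 by (intro card_power_eq_self_le) auto
  moreover have "card (of_nat ` {..<p} :: 'a set) = p"
    by (subst card_image) (auto simp: inj_on_def of_nat_eq_iff_mod)
  moreover have "of_nat ` {..<p} \<subseteq> {x::'a. x ^ p = x}"
    by (auto simp: of_nat_power_p)
  ultimately have "of_nat ` {..<p} = {x::'a. x ^ p = x}"
    by (intro card_seteq) auto
  then show ?thesis
    by auto
qed

lemma funpow_frob: "(frob p l ^^ n) x = (x::'a) ^ p ^ (l * n)"
  by (induction n) (simp_all add: frob_def power_add flip: power_mult, simp add: mult.commute)

lemma funpow_frob_hom:
  fixes x y :: 'a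
  shows "(frob p l ^^ n) 0 = (0::'a)" "(frob p l ^^ n) 1 = (1::'a)"
    "(frob p l ^^ n) (x + y) = (frob p l ^^ n) x + (frob p l ^^ n) y"
    "(frob p l ^^ n) (x * y) = (frob p l ^^ n) x * (frob p l ^^ n) y"
  using p_ge_3 by (simp_all add: funpow_frob power_p_add power_mult_distrib)

lemma funpow_frob_p: "frob p l ^^ p = (id :: 'a \<Rightarrow> 'a)"
  by (rule ext) (simp add: funpow_frob power_p_pl mult.commute[of l])

lemma funpow_frob_cong:
  assumes "m mod p = n mod p"
  shows "frob p l ^^ m = (frob p l ^^ n :: 'a \<Rightarrow> 'a)"
proof
  fix x :: 'a
  have "(frob p l ^^ (k mod p)) x = (frob p l ^^ k) x" for k
    by (rule funpow_mod_eq) (simp add: funpow_frob_p)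
  then show "(frob p l ^^ m) x = (frob p l ^^ n) x"
    using assms by metis
qed

lemma bij_funpow_frob: "bij (frob p l ^^ n :: 'a \<Rightarrow> 'a)"
proof -
  have "(frob p l ^^ n) x = 0 \<Longrightarrow> x = 0" for x :: 'a
    by (simp add: funpow_frob)
  then have "inj (frob p l ^^ n :: 'a \<Rightarrow> 'a)"
    by (intro injI) (metis add_diff_cancel_right' diff_add_cancel eq_iff_diff_eq_0 funpow_frob_hom(3))
  then show ?thesis
    by (simp add: finite_UNIV_inj_surj bij_def)
qed

text \<open>The \<open>p\<close>-th iterate of \<open>frob\<close> is the identity and
  \<open>n\<close> is invertible mod \<open>p\<close>, so \<open>frob\<close> is a power of its own
  \<open>n\<close>-th iterate.\<close>

lemma frob_fixed:
  fixes x :: 'a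
  assumes "(frob p l ^^ n) x = x" "\<not> p dvd n"
  shows "frob p l x = x"
proof -
  have "coprime n p"
    using assms(2) p(1) prime_imp_coprime coprime_commute by blast
  then obtain m where m: "[n * m = 1] (mod p)"
    using cong_solve_coprime_nat by (metis One_nat_def)
  have "(frob p l ^^ (n * m)) x = x"
    by (induction m) (simp_all add: funpow_add assms(1))
  then show ?thesis
    using funpow_frob_cong[of "n * m" 1] m by (simp add: cong_def)
qed

lemma card_Fpl: "card (Fpl p l :: 'a set) \<le> p ^ l"
  unfolding Fpl_def using p_ge_3 l by (intro card_power_eq_self_le one_less_power) auto

text \<open>The number picked by \<open>LEAST\<close> is congruent to \<open>n\<close> mod
  \<open>p\<close>, and the iterates of \<open>frob\<close> depend only on the exponent mod
  \<open>p\<close>.\<close>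

lemma frob_pow_of_nat: "frob_pow p l (of_nat n :: 'a) = frob p l ^^ n"
proof -
  have "of_nat (LEAST m. of_nat m = (of_nat n :: 'a)) = (of_nat n :: 'a)"
    by (rule LeastI[of _ n]) simp
  then show ?thesis
    unfolding frob_pow_def of_nat_eq_iff_mod by (rule funpow_frob_cong)
qed

lemma frob_pow_cases:
  assumes "(e::'a) ^ p = e"
  obtains n where "n < p" "e = of_nat n" "frob_pow p l e = frob p l ^^ n"
  using assms frob_pow_of_nat by (auto simp: prime_field_iff)

lemma frob_pow_add:
  assumes "(e::'a) ^ p = e" "f ^ p = f"
  shows "frob_pow p l (e + f) = frob_pow p l f \<circ> frob_pow p l e"
proof -
  obtain m n where "e = of_nat m" "f = of_nat n"
    using assms frob_pow_cases by metis
  then show ?thesis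
    using frob_pow_of_nat[of "n + m"] by (simp add: frob_pow_of_nat funpow_add add.commute[of "of_nat n"])
qed

text \<open>If a nonzero exponent acted trivially, \<open>frob\<close> would be the identity and the
  whole field would lie in \<open>Fpl p l\<close>, which has at most \<open>p ^ l < q\<close>
  elements.\<close>

lemma frob_pow_eq_id_iff:
  assumes "(e::'a) ^ p = e"
  shows "frob_pow p l e = id \<longleftrightarrow> e = 0"
proof
  assume id: "frob_pow p l e = id"
  obtain n where n: "n < p" "e = of_nat n" "frob_pow p l e = frob p l ^^ n"
    using frob_pow_cases[OF assms] .
  show "e = 0"
  proof (rule ccontr)
    assume "e \<noteq> 0"
    then have "\<not> p dvd n"
      using n by (metis CHAR_eq of_nat_eq_0_iff_char_dvd)
    then have "Fpl p l = (UNIV :: 'a set)"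
      using frob_fixed[of n] n id by (auto simp: Fpl_def frob_def)
    then have "p ^ (p * l) \<le> p ^ l"
      using card_Fpl CARD_eq by simp
    then have "p * l \<le> l"
      using p_ge_3 power_increasing_iff[of p "p * l" l] by simp
    then show False
      using p_ge_3 l by simp
  qed
next
  assume "e = 0"
  then show "frob_pow p l e = id"
    using frob_pow_of_nat[of 0] by auto
qed

section \<open>The linearized polynomial and the trace\<close>

lemma S_eq: "S x = (\<Sum>i<p * l. s i * x ^ p ^ i)"
  by (simp add: lin_poly_def poly_sum poly_monom)

lemma S_0: "S 0 = 0"
  using p_ge_3 by (simp add: S_eq power_0_left)

lemma S_add: "S (x + y) = S x + S y"
  by (simp add: S_eq power_p_add distrib_left sum.distrib)

text \<open>The coefficients of \<open>S\<close> lie in \<open>Fpl p l\<close>, so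
  \<open>frob\<close> fixes them.\<close>

lemma S_funpow_frob: "S ((frob p l ^^ n) x) = (frob p l ^^ n) (S x)"
proof -
  have "S (frob p l x) = frob p l (S x)" for x
    unfolding S_eq frob_def power_p_sum
    by (intro sum.cong refl)
       (use s_Fpl in \<open>auto simp: Fpl_def power_mult_distrib mult.commute simp flip: power_mult\<close>)
  then show ?thesis
    by (induction n) auto
qed

lemma tr_0: "tr p l (0::'a) = 0"
  using p_ge_3 by (simp add: tr_def power_0_left)

lemma tr_add: "tr p l (x + y :: 'a) = tr p l x + tr p l y"
  by (simp add: tr_def power_p_add sum.distrib)

lemma tr_sum: "tr p l (sum f A :: 'a) = (\<Sum>j\<in>A. tr p l (f j))"
  unfolding tr_def power_p_sum by (rule sum.swap)

lemma tr_power_p: "tr p l (x ^ p ^ i :: 'a) = tr p l x"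
proof -
  have "tr p l (x ^ p) = tr p l x" for x :: 'a
  proof -
    \<comment> \<open>The added term of index \<open>p * l\<close> is \<open>x\<close> again;
      splitting off the first term instead of the last leaves the trace of
      \<open>x ^ p\<close>.\<close>
    have "tr p l x + x = (\<Sum>i<Suc (p * l). x ^ p ^ i)"
      by (simp add: tr_def power_p_pl)
    also have "\<dots> = x + tr p l (x ^ p)"
      unfolding sum.lessThan_Suc_shift by (simp add: tr_def power_mult)
    finally show ?thesis
      by simp
  qed
  then show ?thesis
    by (induction i) (simp_all add: power_mult mult.commute[of p])
qed

lemma tr_funpow_frob: "tr p l ((frob p l ^^ n) x :: 'a) = tr p l x"
  by (simp add: funpow_frob tr_power_p)

lemma tr_in_prime_field: "(tr p l x :: 'a) ^ p = tr p l x"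
proof -
  have "(tr p l x :: 'a) ^ p ^ 1 = tr p l (x ^ p ^ 1)"
    unfolding tr_def power_p_sum by (simp add: mult.commute flip: power_mult)
  then show ?thesis
    unfolding tr_power_p by simp
qed

text \<open>Two bounds meet: the kernel is the root set of a nonzero polynomial of degree at most
  \<open>q/p\<close>, and the trace takes at most \<open>p\<close> values.\<close>

lemma card_tr_kernel:
  assumes "(\<mu>::'a) \<noteq> 0"
  shows "p * card {x. tr p l (\<mu> * x) = 0} = CARD('a)"
proof -
  have pl: "p * l = Suc (p * l - 1)"
    using l p_ge_3 by simp
  have q: "CARD('a) = p * p ^ (p * l - 1)"
    using pl by (metis CARD_eq power_Suc)
  define P :: "'a poly" where "P = (\<Sum>i<p * l. monom (\<mu> ^ p ^ i) (p ^ i))"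
  have "coeff P (p ^ (p * l - 1)) = (\<Sum>i<p * l. if i = p * l - 1 then \<mu> ^ p ^ i else 0)"
    unfolding P_def coeff_sum using p_ge_3 by (intro sum.cong) auto
  also have "\<dots> \<noteq> 0"
    using pl assms by simp
  finally have "P \<noteq> 0"
    by auto
  then have "card {x. poly P x = 0} \<le> degree P"
    by (rule card_poly_roots_bound)
  also have "degree P \<le> p ^ (p * l - 1)"
    unfolding P_def
    by (rule degree_sum_le) (use p_ge_3 in \<open>auto intro!: order.trans[OF degree_monom_le]\<close>)
  finally have "card {x. poly P x = 0} \<le> p ^ (p * l - 1)" .
  moreover have "poly P x = tr p l (\<mu> * x)" for x
    by (simp add: P_def tr_def poly_sum poly_monom power_mult_distrib)
  ultimately have "card {x. tr p l (\<mu> * x) = 0} \<le> p ^ (p * l - 1)"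
    by simp
  then have "p * card {x. tr p l (\<mu> * x) = 0} \<le> CARD('a)"
    by (simp add: q)
  moreover have "CARD('a) \<le> p * card {x. tr p l (\<mu> * x) = 0}"
  proof -
    have tr_diff: "tr p l (\<mu> * (y - x)) = tr p l (\<mu> * y) - tr p l (\<mu> * x)" for x y
      using tr_add[of "\<mu> * (y - x)" "\<mu> * x"] by (simp add: algebra_simps)
    have "CARD('a) \<le> card (range (\<lambda>x. tr p l (\<mu> * x))) * card {x. tr p l (\<mu> * x) = 0}"
      by (rule card_le_image_times_fibre[where d = "\<lambda>x y. y - x"]) (auto simp: tr_diff)
    also have "card (range (\<lambda>x. tr p l (\<mu> * x))) \<le> card (of_nat ` {..<p} :: 'a set)"
      using tr_in_prime_field prime_field_iff by (intro card_mono) auto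
    also have "\<dots> \<le> p"
      using card_image_le[of "{..<p}" "of_nat :: nat \<Rightarrow> 'a"] by simp
    finally show ?thesis
      by simp
  qed
  ultimately show ?thesis
    by simp
qed

end

section \<open>The groups and their abelian subgroups\<close>

text \<open>
  The parameter \<open>e\<close> is the exponent of \<open>g\<close> in \<open>\<theta>\<^bsub>a,b,c\<^esub>\<close>, which in both constructions does not
  depend on \<open>a\<close>; \<open>e_mult\<close> says that it is additive along the group multiplication.
\<close>

locale frob_group = frob_field p l s
  for p l :: nat and s :: "nat \<Rightarrow> 'a::{field, finite}" +
  fixes e :: "'a \<Rightarrow> 'a \<Rightarrow> 'a"
  assumes e_prime_field: "e b c ^ p = e b c"
    and e_mult: "e ((frob p l ^^ n) b1 + b2 + (frob p l ^^ n) c1 * S c2) ((frob p l ^^ n) c1 + c2) =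
                 e b1 c1 + e b2 c2"
    and degree_gt_1: "1 < degree (lin_poly p l s)"
    and degree_less: "p * degree (lin_poly p l s) < CARD('a)"
    and e_kernel: "CARD('a) \<le> p * card {b. e b 0 = 0}"
begin

abbreviation \<theta> :: "'a \<Rightarrow> 'a \<Rightarrow> 'a \<Rightarrow> 'a \<Rightarrow> 'a" where
  "\<theta> \<equiv> \<lambda>a b c. frob_pow p l (e b c)"

abbreviation el :: "'a \<Rightarrow> 'a \<Rightarrow> 'a \<Rightarrow> 'a sl_pair" where
  "el \<equiv> gelem (T_S1 p l s) \<theta>"

abbreviation G :: "'a sl_pair monoid" where
  "G \<equiv> ggroup (T_S1 p l s) \<theta>"

text \<open>The set called \<open>H\<close> in the overview.\<close>

abbreviation J :: "'a sl_pair set" where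
  "J \<equiv> {el a b 0 | a b. \<theta> a b 0 = id}"

lemma e_0: "e 0 0 = 0"
proof -
  have "e 0 0 + e 0 0 = e 0 0 + 0"
    using e_mult[of 0 0 0 0 0] S_0 by simp
  then show ?thesis
    by (rule add_left_imp_eq)
qed

lemma \<theta>_0: "\<theta> a 0 0 = id"
  by (subst frob_pow_eq_id_iff[OF e_prime_field]) (rule e_0)

lemma \<theta>_cases:
  obtains n where "n < p" "\<theta> a b c = frob p l ^^ n"
  using frob_pow_cases[OF e_prime_field] .

lemma \<theta>_hom:
  "\<theta> a b c 0 = 0" "\<theta> a b c 1 = 1" "\<theta> a b c (x + y) = \<theta> a b c x + \<theta> a b c y"
  "\<theta> a b c (x * y) = \<theta> a b c x * \<theta> a b c y"
  by (rule \<theta>_cases[of b c], simp add: funpow_frob_hom)+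

lemma \<theta>_surj: "\<exists>y. \<theta> a b c y = x"
proof -
  obtain n where "\<theta> a b c = frob p l ^^ n"
    by (rule \<theta>_cases)
  then show ?thesis
    using bij_is_surj[OF bij_funpow_frob[of n]] by (metis surjD)
qed

lemma \<theta>_fixed:
  assumes "\<theta> a b c x = x" "\<theta> a b c \<noteq> id"
  shows "x \<in> Fpl p l"
proof -
  obtain n where n: "n < p" "\<theta> a b c = frob p l ^^ n"
    by (rule \<theta>_cases)
  with assms(2) have "\<not> p dvd n"
    by (auto dest: dvd_imp_le)
  then show ?thesis
    using frob_fixed[of n x] assms(1) n by (simp add: Fpl_def frob_def)
qed

section \<open>The group law\<close>

text \<open>The product is again of the form \<open>el\<close> because \<open>S\<close> is additive
  and commutes with \<open>\<sigma>\<close>, while \<open>e_mult\<close> matches the automorphism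
  parts.\<close>

lemma el_mult:
  "pair_mult (el a1 b1 c1) (el a2 b2 c2) =
    (let \<sigma> = \<theta> a2 b2 c2 in
     el (\<sigma> a1 + a2 - \<sigma> b1 * c2 + \<sigma> c1 * b2 - \<sigma> c1 * c2 * S c2) (\<sigma> b1 + b2 + \<sigma> c1 * S c2) (\<sigma> c1 + c2))"
proof -
  define \<sigma> where "\<sigma> = \<theta> a2 b2 c2"
  obtain n where n: "\<sigma> = frob p l ^^ n"
    unfolding \<sigma>_def by (rule \<theta>_cases)
  have "frob_pow p l (e (\<sigma> b1 + b2 + \<sigma> c1 * S c2) (\<sigma> c1 + c2)) = \<sigma> \<circ> \<theta> a1 b1 c1"
    unfolding n e_mult frob_pow_add[OF e_prime_field e_prime_field] by (simp add: \<sigma>_def flip: n)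
  moreover have "\<sigma> (S c1) + S c2 = S (\<sigma> c1 + c2)"
    by (simp add: n S_add S_funpow_frob)
  moreover have "map_matrix \<sigma> (E a1 b1 c1 (S c1)) ** E a2 b2 c2 (S c2) =
    E (\<sigma> a1 + a2 - \<sigma> b1 * c2 + \<sigma> c1 * b2 - \<sigma> c1 * c2 * S c2) (\<sigma> b1 + b2 + \<sigma> c1 * S c2)
      (\<sigma> c1 + c2) (\<sigma> (S c1) + S c2)"
    by (rule E_mult) (simp_all add: \<sigma>_def \<theta>_hom)
  ultimately show ?thesis
    by (simp add: gelem_def T_S1_def Let_def flip: \<sigma>_def)
qed

lemma el_eq_iff: "el a b c = el a' b' c' \<longleftrightarrow> a = a' \<and> b = b' \<and> c = c'"
  by (auto simp: gelem_def E_eq_iff)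

lemma el_0: "el 0 0 0 = (mat 1, id)"
  using \<theta>_0 by (simp add: gelem_def T_S1_def S_0 E_0)

lemma G_simps:
  "carrier G = {el a b c | a b c. True}" "x \<otimes>\<^bsub>G\<^esub> y = pair_mult x y" "\<one>\<^bsub>G\<^esub> = el 0 0 0"
  by (simp_all add: ggroup_def el_0)

lemma snd_el: "snd (el a b c) = \<theta> a b c"
  by (simp add: gelem_def)

lemma group_G: "group G"
proof (rule groupI)
  show "x \<otimes>\<^bsub>G\<^esub> y \<in> carrier G" if "x \<in> carrier G" "y \<in> carrier G" for x y
    using that by (auto simp: G_simps el_mult Let_def el_eq_iff)
  show "\<one>\<^bsub>G\<^esub> \<in> carrier G"
    by (auto simp: G_simps)
  show "\<one>\<^bsub>G\<^esub> \<otimes>\<^bsub>G\<^esub> x = x" if "x \<in> carrier G" for x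
    using that by (auto simp: G_simps el_mult Let_def \<theta>_hom)
  show "x \<otimes>\<^bsub>G\<^esub> y \<otimes>\<^bsub>G\<^esub> z = x \<otimes>\<^bsub>G\<^esub> (y \<otimes>\<^bsub>G\<^esub> z)"
    if "x \<in> carrier G" "y \<in> carrier G" "z \<in> carrier G" for x y z
  proof -
    have hom: "map_matrix (\<theta> a b c) (A ** B) = map_matrix (\<theta> a b c) A ** map_matrix (\<theta> a b c) B"
      for a b c and A B :: "'a^4^4"
      by (simp add: vec_eq_iff matrix_matrix_mult_def sum_4 \<theta>_hom)
    have comp: "map_matrix f (map_matrix g A) = map_matrix (f \<circ> g) A" for f g :: "'a \<Rightarrow> 'a" and A :: "'a^4^4"
      by (simp add: vec_eq_iff)
    show ?thesis
      using that by (auto simp: G_simps(1,2) gelem_def hom comp matrix_mul_assoc comp_assoc)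
  qed
  show "\<exists>y\<in>carrier G. y \<otimes>\<^bsub>G\<^esub> x = \<one>\<^bsub>G\<^esub>" if x: "x \<in> carrier G" for x
  proof -
    obtain a b c where x: "x = el a b c"
      using x by (auto simp: G_simps)
    \<comment> \<open>A left inverse comes from setting the formula of \<open>el_mult\<close> equal
      to \<open>el 0 0 0\<close> and solving for \<open>c'\<close>, \<open>b'\<close> and
      \<open>a'\<close> in this order.\<close>
    obtain c' where c': "\<theta> a b c c' = - c"
      using \<theta>_surj by blast
    obtain b' where b': "\<theta> a b c b' = - b + c * S c"
      using \<theta>_surj by blast
    obtain a' where a': "\<theta> a b c a' = - a + (- b + c * S c) * c + c * b - c * c * S c"
      using \<theta>_surj by blast
    have "el a' b' c' \<otimes>\<^bsub>G\<^esub> x = \<one>\<^bsub>G\<^esub>"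
      unfolding x G_simps el_mult Let_def a' b' c' by (simp add: el_eq_iff algebra_simps)
    then show ?thesis
      using G_simps(1) by blast
  qed
qed

lemma \<theta>_eq_id_iff: "\<theta> a b c = id \<longleftrightarrow> e b c = 0"
  by (rule frob_pow_eq_id_iff[OF e_prime_field])

section \<open>The abelian subgroup \<open>J\<close>\<close>

lemma J_subset: "J \<subseteq> carrier G"
  by (auto simp: G_simps)

lemma card_J: "card J = CARD('a) * card {b. e b 0 = 0}"
proof -
  have "J = (\<lambda>(a, b). el a b 0) ` (UNIV \<times> {b. e b 0 = 0})"
    by (rule Set.set_eqI) (simp add: image_iff Bex_def \<theta>_eq_id_iff; blast)
  moreover have "inj_on (\<lambda>(a, b). el a b 0) (UNIV \<times> {b. e b 0 = 0})"
    by (auto simp: inj_on_def el_eq_iff)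
  ultimately show ?thesis
    by (simp add: card_image card_cartesian_product)
qed

text \<open>Only the automorphism of the right factor acts, hence the condition on
  \<open>b'\<close>. On \<open>J\<close> the product is coordinatewise addition, which gives
  commutativity.\<close>

lemma J_mult:
  assumes "e b' 0 = 0"
  shows "el a b 0 \<otimes>\<^bsub>G\<^esub> el a' b' 0 = el (a + a') (b + b') 0"
proof -
  have "\<theta> a' b' 0 = id"
    by (subst \<theta>_eq_id_iff) (rule assms)
  then show ?thesis
    by (simp add: G_simps el_mult Let_def S_0)
qed

lemma abelian_subgroup_J: "abelian_subgroup G J"
proof -
  interpret group G
    by (rule group_G)
  have add: "e (b + b') 0 = 0" if "e b 0 = 0" "e b' 0 = 0" for b b'
    using e_mult[of 0 b b' 0 0] that by (simp add: S_0)
  have minus: "e (- b) 0 = 0" if "e b 0 = 0" for b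
    using e_mult[of 0 b "- b" 0 0] that by (simp add: S_0 e_0)
  have sub: "subgroup J G"
  proof (rule subgroupI)
    show "J \<noteq> {}"
      using \<theta>_0 by blast
    show "inv\<^bsub>G\<^esub> x \<in> J" if x: "x \<in> J" for x
    proof -
      obtain a b where ab: "x = el a b 0" "e b 0 = 0"
        using x by (auto simp: \<theta>_eq_id_iff)
      have "el (- a) (- b) 0 \<otimes>\<^bsub>G\<^esub> x = \<one>\<^bsub>G\<^esub>"
        unfolding ab(1) G_simps(3) using J_mult[OF ab(2)] by simp
      then have "inv\<^bsub>G\<^esub> x = el (- a) (- b) 0"
        by (rule inv_equality) (auto simp: G_simps ab)
      then show ?thesis
        using minus[OF ab(2)] by (auto simp: \<theta>_eq_id_iff)
    qed
    show "x \<otimes>\<^bsub>G\<^esub> y \<in> J" if xy: "x \<in> J" "y \<in> J" for x y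
    proof -
      obtain a b a' b' where "x = el a b 0" "e b 0 = 0" "y = el a' b' 0" "e b' 0 = 0"
        using xy by (auto simp: \<theta>_eq_id_iff)
      then show ?thesis
        using J_mult[of b' a b a'] add[of b b'] by (auto simp: \<theta>_eq_id_iff)
    qed
  qed (use J_subset in auto)
  moreover have "comm_group (G\<lparr>carrier := J\<rparr>)"
  proof (rule group.group_comm_groupI)
    show "group (G\<lparr>carrier := J\<rparr>)"
      using sub by (rule subgroup.subgroup_is_group) (rule group_G)
    show "x \<otimes>\<^bsub>G\<lparr>carrier := J\<rparr>\<^esub> y = y \<otimes>\<^bsub>G\<lparr>carrier := J\<rparr>\<^esub> x"
      if xy: "x \<in> carrier (G\<lparr>carrier := J\<rparr>)" "y \<in> carrier (G\<lparr>carrier := J\<rparr>)" for x y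
    proof -
      obtain a b a' b' where "x = el a b 0" "e b 0 = 0" "y = el a' b' 0" "e b' 0 = 0"
        using xy by (auto simp: \<theta>_eq_id_iff)
      then show ?thesis
        using J_mult[of b' a b a'] J_mult[of b a' b' a] by (simp add: add.commute)
    qed
  qed
  ultimately show ?thesis
    by (simp add: abelian_subgroup_def)
qed

section \<open>The bound for other abelian subgroups, and maximality of \<open>J\<close>\<close>

lemma card_abelian_subgroup_less:
  assumes "abelian_subgroup G A" "\<not> A \<subseteq> J"
  shows "p * card A < CARD('a) ^ 2"
proof -
  interpret group G
    by (rule group_G)
  have A: "subgroup A G"
    using assms(1) by (simp add: abelian_subgroup_def)
  have A_el: "\<exists>a b c. x = el a b c" if "x \<in> A" for x
    using subgroup.mem_carrier[OF A that] by (auto simp: G_simps)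
  have comm: "pair_mult x y = pair_mult y x" if "x \<in> A" "y \<in> A" for x y
    using assms(1) that comm_group.axioms(1)[THEN comm_monoid.m_comm, of "G\<lparr>carrier := A\<rparr>" x y]
    by (simp add: abelian_subgroup_def G_simps)
  \<comment> \<open>These quotients are the \<open>d\<close> of
    \<open>card_le_image_times_fibre\<close> in the two counts over \<open>A\<close> and
    \<open>A0\<close>.\<close>
  have quot: "\<exists>z\<in>A. inv\<^bsub>G\<^esub> x \<otimes>\<^bsub>G\<^esub> y = z \<and> y = pair_mult x z" if "x \<in> A" "y \<in> A" for x y
  proof -
    have "inv\<^bsub>G\<^esub> x \<otimes>\<^bsub>G\<^esub> y \<in> A"
      using A that by (simp add: subgroup.m_closed subgroup.m_inv_closed)
    moreover have "x \<otimes>\<^bsub>G\<^esub> (inv\<^bsub>G\<^esub> x \<otimes>\<^bsub>G\<^esub> y) = y"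
      using subgroup.mem_carrier[OF A] that by (simp flip: m_assoc)
    ultimately show ?thesis
      by (auto simp: G_simps(2))
  qed
  have quot_inj: "y = z" if "x \<in> A" "y \<in> A" "z \<in> A" "inv\<^bsub>G\<^esub> x \<otimes>\<^bsub>G\<^esub> y = inv\<^bsub>G\<^esub> x \<otimes>\<^bsub>G\<^esub> z" for x y z
    using subgroup.mem_carrier[OF A] that by simp
  have fin: "finite (carrier G)"
  proof -
    have "carrier G = (\<lambda>(a, b, c). el a b c) ` UNIV"
      by (rule Set.set_eqI) (simp add: G_simps image_iff; blast)
    then show ?thesis
      by simp
  qed
  then have finA: "finite A"
    using subgroup.subset[OF A] finite_subset by blast
  define d where "d = degree (lin_poly p l s)"
  define cc where "cc = (\<lambda>x :: 'a sl_pair. fst x $ 4 $ 3)"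
  have cc: "cc (el a b c) = c" for a b c
    by (simp add: cc_def gelem_def E_nth)
  \<comment> \<open>\<open>A0\<close> is the kernel of the automorphism part on \<open>A\<close>,
    and \<open>K\<close> the kernel of the \<open>c\<close> entry on \<open>A0\<close>. Hence
    \<open>card A\<close> is at most the number of automorphisms times the number of
    \<open>c\<close> entries times \<open>card K\<close>.\<close>
  define A0 where "A0 = {x \<in> A. snd x = id}"
  define K where "K = {x \<in> A0. cc x = 0}"
  have finA0: "finite A0" and finK: "finite K"
    using finA by (simp_all add: A0_def K_def)

  have "card (cc ` A0) \<le> d"
  proof (cases "cc ` A0 \<subseteq> {0}")
    case True
    then have "card (cc ` A0) \<le> card {0::'a}"
      by (intro card_mono) auto
    then show ?thesis
      using degree_gt_1 by (simp add: d_def)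
  next
    case False
    then obtain x1 where x1: "x1 \<in> A" "snd x1 = id" "cc x1 \<noteq> 0"
      by (auto simp: A0_def)
    then obtain a1 b1 c1 where el1: "x1 = el a1 b1 c1"
      using A_el by blast
    have c1: "c1 \<noteq> 0" "\<theta> a1 b1 c1 = id"
      using x1 by (simp_all add: el1 cc snd_el)
    define P where "P = lin_poly p l s - monom (S c1 / c1) 1"
    \<comment> \<open>Degree above 1 matters here: subtracting a linear term then keeps the degree,
      so \<open>P\<close> is not zero.\<close>
    have "degree (monom (S c1 / c1) 1) < degree (lin_poly p l s)"
      using degree_gt_1 degree_monom_le[of "S c1 / c1" 1] by linarith
    then have deg: "degree P = d"
      unfolding P_def d_def diff_conv_add_uminus by (intro degree_add_eq_left) simp
    then have "P \<noteq> 0"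
      using degree_gt_1 by (auto simp: d_def)
    have "cc ` A0 \<subseteq> {x. poly P x = 0}"
    proof safe
      fix x assume x: "x \<in> A0"
      then obtain a b c where el: "x = el a b c"
        using A_el unfolding A0_def by blast
      have c: "\<theta> a b c = id"
        using x by (simp add: el A0_def snd_el)
      \<comment> \<open>Comparison of the \<open>b\<close> entries of the two products.\<close>
      have "c1 * S c = c * S c1"
        using comm[of x x1] x x1(1) by (simp add: A0_def el el1 el_mult c c1(2) Let_def el_eq_iff)
      then show "poly P (cc x) = 0"
        using c1 by (simp add: el cc P_def poly_monom field_simps)
    qed
    then have "card (cc ` A0) \<le> card {x. poly P x = 0}"
      by (intro card_mono) auto
    also have "\<dots> \<le> d"
      using card_poly_roots_bound[OF \<open>P \<noteq> 0\<close>] deg by simp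
    finally show ?thesis .
  qed
  moreover have "card A0 \<le> card (cc ` A0) * card K"
  proof (rule card_le_image_times_fibre[where d = "\<lambda>x y. inv\<^bsub>G\<^esub> x \<otimes>\<^bsub>G\<^esub> y"])
    fix x y assume xy: "x \<in> A0" "y \<in> A0" "cc x = cc y"
    then obtain z where z: "z \<in> A" "inv\<^bsub>G\<^esub> x \<otimes>\<^bsub>G\<^esub> y = z" "y = pair_mult x z"
      using quot[of x y] unfolding A0_def by blast
    obtain a b c a' b' c' where el: "x = el a b c" "z = el a' b' c'"
      using A_el z(1) xy(1) unfolding A0_def by blast
    have "snd y = snd z \<circ> snd x"
      unfolding z(3) by (cases x; cases z) simp
    then have "snd z = id"
      using xy by (simp add: A0_def)
    then have id: "\<theta> a' b' c' = id"
      by (simp add: el snd_el)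
    have "c' = 0"
      using xy(3) unfolding z(3) by (simp add: el el_mult Let_def id cc)
    then show "inv\<^bsub>G\<^esub> x \<otimes>\<^bsub>G\<^esub> y \<in> K"
      using z \<open>snd z = id\<close> by (simp add: K_def A0_def el cc)
  qed (use finA0 finK quot_inj in \<open>auto simp: A0_def\<close>)
  ultimately have A0: "card A0 \<le> d * card K"
    by (meson le_trans mult_le_mono1)
  have K_el: "\<exists>a b. x = el a b 0 \<and> x \<in> A \<and> \<theta> a b 0 = id" if "x \<in> K" for x
    using that A_el[of x] by (auto simp: K_def A0_def cc snd_el el_eq_iff)
  have pd: "p * d < CARD('a)"
    using degree_less by (simp add: d_def)

  show ?thesis
  proof (cases "A \<subseteq> A0")
    case True
    then have "A = A0"
      by (auto simp: A0_def)
    obtain x1 where x1: "x1 \<in> A" "x1 \<notin> J"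
      using assms(2) by blast
    then obtain a1 b1 c1 where el1: "x1 = el a1 b1 c1"
      using A_el by blast
    have id1: "\<theta> a1 b1 c1 = id"
      using x1(1) True by (auto simp: el1 A0_def snd_el)
    then have c1: "c1 \<noteq> 0"
      using x1(2) el1 by auto
    have "K \<subseteq> range (\<lambda>a. el a 0 0)"
    proof
      fix x assume "x \<in> K"
      then obtain a b where x: "x = el a b 0" "x \<in> A" "\<theta> a b 0 = id"
        using K_el by blast
      \<comment> \<open>The \<open>a\<close> entries of the two products are
        \<open>a + a1 - b * c1\<close> and \<open>a1 + a + c1 * b\<close>.\<close>
      have "c1 * b = - (b * c1)"
        using comm[OF x(2) x1(1)] by (simp add: x(1,3) el1 id1 el_mult Let_def el_eq_iff S_0 algebra_simps)
      then have "2 * (c1 * b) = 0"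
        by (simp add: algebra_simps)
      then show "x \<in> range (\<lambda>a. el a 0 0)"
        using c1 two_nonzero by (auto simp: x(1))
    qed
    then have "card K \<le> card (range (\<lambda>a. el a 0 0))"
      by (intro card_mono) auto
    also have "\<dots> \<le> CARD('a)"
      by (rule card_image_le) simp
    finally have "card A \<le> d * CARD('a)"
      using A0 \<open>A = A0\<close> by (meson le_trans mult_le_mono2)
    then have "p * card A \<le> (p * d) * CARD('a)"
      by (simp add: mult.assoc)
    also have "\<dots> < CARD('a) * CARD('a)"
      using pd by simp
    finally show ?thesis
      by (simp add: power2_eq_square)
  next
    case False
    then obtain x1 where x1: "x1 \<in> A" "snd x1 \<noteq> id"
      by (auto simp: A0_def)
    then obtain a1 b1 c1 where el1: "x1 = el a1 b1 c1"
      using A_el by blast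
    define \<sigma> where "\<sigma> = \<theta> a1 b1 c1"
    have \<sigma>: "\<sigma> \<noteq> id"
      using x1(2) by (simp add: el1 snd_el \<sigma>_def)
    have fixed: "x \<in> Fpl p l" if "\<sigma> x = x" for x
      using \<theta>_fixed that \<sigma> unfolding \<sigma>_def by blast
    have K: "\<sigma> b = b \<and> \<sigma> a = a + 2 * (c1 * b)" if "el a b 0 \<in> K" for a b
    proof -
      have ab: "el a b 0 \<in> A" "\<theta> a b 0 = id"
        using K_el[OF that] by (auto simp: el_eq_iff)
      \<comment> \<open>The two equations compare the \<open>b\<close> entries and the
        \<open>a\<close> entries.\<close>
      have "\<sigma> b = b \<and> \<sigma> a - \<sigma> b * c1 = a + c1 * b"
        using comm[OF ab(1) x1(1)]
        by (auto simp: ab(2) el1 el_mult Let_def el_eq_iff S_0 algebra_simps simp flip: \<sigma>_def)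
      then show ?thesis
        by (auto simp: algebra_simps)
    qed
    define aa where "aa = (\<lambda>x :: 'a sl_pair. fst x $ 4 $ 1)"
    define bb where "bb = (\<lambda>x :: 'a sl_pair. fst x $ 4 $ 2)"
    have aabb: "aa (el a b c) = a" "bb (el a b c) = b" for a b c
      by (simp_all add: aa_def bb_def gelem_def E_nth)
    have "card K \<le> card (bb ` K) * card (Fpl p l :: 'a set)"
    proof (rule card_le_image_times_fibre[where d = "\<lambda>x y. aa y - aa x"])
      fix x y assume xy: "x \<in> K" "y \<in> K" "bb x = bb y"
      then obtain a b a' where el: "x = el a b 0" "y = el a' b 0"
        using K_el aabb by metis
      \<comment> \<open>For equal \<open>b\<close> the term \<open>2 * (c1 * b)\<close> cancels, so
        the difference of the \<open>a\<close> entries is fixed by \<open>\<sigma>\<close>.\<close>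
      have "\<sigma> (a' - a) + \<sigma> a = \<sigma> a'"
        by (simp add: \<sigma>_def flip: \<theta>_hom(3))
      then have "\<sigma> (a' - a) = a' - a"
        using K[of a b] K[of a' b] xy(1,2) by (simp add: el algebra_simps)
      then show "aa y - aa x \<in> Fpl p l"
        using fixed by (simp add: el aabb)
    next
      fix x y z assume "x \<in> K" "y \<in> K" "z \<in> K" "bb y = bb x" "bb z = bb x" "aa y - aa x = aa z - aa x"
      then show "y = z"
        using K_el[of y] K_el[of z] by (auto simp: aabb)
    qed (use finK in auto)
    also have "card (bb ` K) \<le> card (Fpl p l :: 'a set)"
      using K K_el fixed aabb by (intro card_mono) (auto, metis)
    finally have "card K \<le> p ^ l * p ^ l"
      using card_Fpl by (meson le_trans mult_le_mono mult_le_mono1)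
    then have "card A0 \<le> d * p ^ (2 * l)"
      using A0 by (metis le_trans mult_2 mult_le_mono2 power_add)
    moreover have "card A \<le> card (snd ` A) * card A0"
    proof (rule card_le_image_times_fibre[where d = "\<lambda>x y. inv\<^bsub>G\<^esub> x \<otimes>\<^bsub>G\<^esub> y"])
      fix x y assume xy: "x \<in> A" "y \<in> A" "snd x = snd y"
      then obtain z where z: "z \<in> A" "inv\<^bsub>G\<^esub> x \<otimes>\<^bsub>G\<^esub> y = z" "y = pair_mult x z"
        using quot[of x y] by blast
      obtain a b c where el: "x = el a b c"
        using A_el xy(1) by blast
      have "snd y = snd z \<circ> snd x"
        unfolding z(3) by (cases x; cases z) simp
      \<comment> \<open>Thus \<open>snd z\<close> is the identity on the image of
        \<open>\<theta> a b c\<close>, which is the whole field.\<close>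
      then have im: "snd z (\<theta> a b c u) = \<theta> a b c u" for u
        using xy(3) by (metis comp_apply el snd_el)
      have "snd z = id"
      proof
        fix v
        obtain u where "\<theta> a b c u = v"
          using \<theta>_surj by blast
        then show "snd z v = id v"
          using im[of u] by simp
      qed
      then show "inv\<^bsub>G\<^esub> x \<otimes>\<^bsub>G\<^esub> y \<in> A0"
        using z by (simp add: A0_def)
    qed (use finA finA0 quot_inj in auto)
    moreover have "card (snd ` A) \<le> p"
    proof -
      have "snd ` A \<subseteq> (\<lambda>n. frob p l ^^ n) ` {..<p}"
      proof
        fix f assume "f \<in> snd ` A"
        then obtain x where x: "x \<in> A" "f = snd x"
          by blast
        then obtain a b c where "x = el a b c"
          using A_el by blast
        then have f: "f = \<theta> a b c"
          using x(2) by (simp add: snd_el)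
        obtain n where "n < p" "\<theta> a b c = frob p l ^^ n"
          by (rule \<theta>_cases)
        then show "f \<in> (\<lambda>n. frob p l ^^ n) ` {..<p}"
          unfolding f by blast
      qed
      then have "card (snd ` A) \<le> card ((\<lambda>n. frob p l ^^ n :: 'a \<Rightarrow> 'a) ` {..<p})"
        by (intro card_mono) auto
      also have "\<dots> \<le> p"
        using card_image_le[of "{..<p}" "\<lambda>n. frob p l ^^ n :: 'a \<Rightarrow> 'a"] by simp
      finally show ?thesis .
    qed
    ultimately have "card A \<le> p * (d * p ^ (2 * l))"
      by (meson le_trans mult_le_mono)
    then have "p * card A \<le> (p * d) * p ^ (2 * l + 1)"
      using mult_le_mono2[of "card A" "p * (d * p ^ (2 * l))" p] by (simp add: mult_ac)
    also have "\<dots> < CARD('a) * p ^ (2 * l + 1)"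
      using pd p_ge_3 by simp
    also have "\<dots> \<le> CARD('a) * CARD('a)"
    proof -
      \<comment> \<open>The exponent \<open>2 * l\<close> comes from \<open>K\<close> and the 1 from
        the automorphisms; \<open>l \<ge> 1\<close> and \<open>p \<ge> 3\<close> keep the total
        within \<open>p * l\<close>.\<close>
      have "2 * l + 1 \<le> 3 * l"
        using l by simp
      also have "\<dots> \<le> p * l"
        using p_ge_3 by simp
      finally have "p ^ (2 * l + 1) \<le> p ^ (p * l)"
        using p_ge_3 by (intro power_increasing) auto
      then show ?thesis
        by (simp add: CARD_eq)
    qed
    finally show ?thesis
      by (simp add: power2_eq_square)
  qed
qed

text \<open>Abelian subgroups not inside \<open>J\<close> are strictly smaller than
  \<open>J\<close>, so \<open>J\<close> alone attains the maximal order; being a subgroup, it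
  generates itself.\<close>

lemma thompson_subgroup_eq: "thompson_subgroup G = J"
proof -
  interpret group G
    by (rule group_G)
  have card_J_ge: "CARD('a) ^ 2 \<le> p * card J"
    using mult_le_mono2[OF e_kernel, of "CARD('a)"] by (simp add: card_J power2_eq_square mult_ac)
  have less: "card A < card J" if "abelian_subgroup G A" "\<not> A \<subseteq> J" for A
  proof -
    have "p * card A < p * card J"
      using card_abelian_subgroup_less[OF that] card_J_ge by (rule less_le_trans)
    then show ?thesis
      by simp
  qed
  \<comment> \<open>Infinite sets have \<open>card\<close> 0, so this yields finiteness of
    \<open>J\<close>.\<close>
  have "card J \<noteq> 0"
  proof
    assume zero: "card J = 0"
    show False
      using card_J_ge unfolding zero by simp
  qed
  then have fin: "finite J"
    by (rule card_ge_0_finite[OF neq0_conv[THEN iffD1]])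
  have le: "card A \<le> card J" if "abelian_subgroup G A" for A
    using less[OF that] card_mono[OF fin] by fastforce
  have "max_order_abelian_subgroups G = {J}"
  proof (rule antisym)
    show "{J} \<subseteq> max_order_abelian_subgroups G"
      using abelian_subgroup_J le by (simp add: max_order_abelian_subgroups_def)
    show "max_order_abelian_subgroups G \<subseteq> {J}"
    proof
      fix A assume "A \<in> max_order_abelian_subgroups G"
      then have A: "abelian_subgroup G A" "card J \<le> card A"
        using abelian_subgroup_J by (simp_all add: max_order_abelian_subgroups_def)
      then have "A \<subseteq> J"
        using less by fastforce
      then show "A \<in> {J}"
        using card_seteq[OF fin] A(2) by blast
    qed
  qed
  moreover have "generate G J = J"
    using abelian_subgroup_J generateI[of J J] by (simp add: abelian_subgroup_def)
  ultimately show ?thesis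
    by (simp add: thompson_subgroup_def)
qed

end

section \<open>The exponents of the two constructions\<close>

context frob_field
begin

lemma tr_mult_funpow_frob:
  assumes "(\<mu>::'a) \<in> Fpl p l"
  shows "tr p l (\<mu> * (frob p l ^^ n) x) = tr p l (\<mu> * x)"
proof -
  have "(frob p l ^^ n) \<mu> = \<mu>"
    using assms by (induction n) (simp_all add: Fpl_def frob_def)
  then show ?thesis
    using tr_funpow_frob[of n "\<mu> * x"] by (simp add: funpow_frob_hom)
qed

text \<open>The condition on the coefficients makes \<open>S\<close> self-adjoint for the form
  \<open>tr p l (\<mu> * x * y)\<close>: the terms of index \<open>i\<close> and
  \<open>p * l - i\<close> are exchanged, and the term of index 0 is symmetric by itself.\<close>

lemma tr_S_sym:
  assumes "\<forall>i\<in>{1..p * l - 1}. \<mu> * s i - s (p * l - i) ^ (p ^ i) * \<mu> ^ (p ^ i) = 0"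
  shows "tr p l (\<mu> * x * S y) = tr p l (\<mu> * y * S x)"
proof -
  have pl: "p * l > 0"
    using p_ge_3 l by simp
  have split: "(\<Sum>i<p * l. f i) = f 0 + (\<Sum>i\<in>{1..p * l - 1}. f i)" for f :: "nat \<Rightarrow> 'a"
  proof -
    have "{..<p * l} = insert 0 {1..p * l - 1}"
      using pl by auto
    then show ?thesis
      by simp
  qed
  have expand: "tr p l (\<mu> * x * S y) = (\<Sum>i<p * l. tr p l (\<mu> * s i * x * y ^ p ^ i))" for x y
    by (simp add: S_eq sum_distrib_left tr_sum mult_ac)
  have "(\<Sum>i\<in>{1..p * l - 1}. tr p l (\<mu> * s i * x * y ^ p ^ i)) =
        (\<Sum>i\<in>{1..p * l - 1}. tr p l (\<mu> * s i * y * x ^ p ^ i))"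
  proof (rule sum.reindex_bij_witness[of _ "\<lambda>i. p * l - i" "\<lambda>i. p * l - i"])
    fix i assume i: "i \<in> {1..p * l - 1}"
    have "p * l - i + i = p * l"
      using i by auto
    \<comment> \<open>The trace is invariant under this power, which turns the power of
      \<open>x\<close> into \<open>x ^ p ^ (p * l) = x\<close>.\<close>
    then have "(\<mu> * s (p * l - i) * y * x ^ p ^ (p * l - i)) ^ p ^ i =
          (\<mu> ^ p ^ i * s (p * l - i) ^ p ^ i) * y ^ p ^ i * x ^ p ^ (p * l)"
      by (simp add: power_mult_distrib flip: power_mult power_add)
    also have "\<dots> = \<mu> * s i * x * y ^ p ^ i"
      unfolding power_p_pl using bspec[OF assms i] by (simp add: mult_ac)
    finally show "tr p l (\<mu> * s (p * l - i) * y * x ^ p ^ (p * l - i)) = tr p l (\<mu> * s i * x * y ^ p ^ i)"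
      using tr_power_p by metis
  qed auto
  then show ?thesis
    unfolding expand split by (simp add: mult_ac)
qed

text \<open>By self-adjointness the cross term of half the quadratic form \<open>Q_C\<close> is
  minus the added trace, which is the contribution of \<open>c1\<close> and \<open>c2\<close> to the
  \<open>b\<close> entry of a product.\<close>

lemma Q_C_add_funpow_frob:
  assumes "\<mu> \<in> Fpl p l"
    and "\<forall>i\<in>{1..p * l - 1}. \<mu> * s i - s (p * l - i) ^ (p ^ i) * \<mu> ^ (p ^ i) = 0"
  shows "1 / 2 * Q_C p l \<mu> s ((frob p l ^^ n) x + y) + tr p l (\<mu> * (frob p l ^^ n) x * S y) =
    1 / 2 * Q_C p l \<mu> s x + 1 / 2 * Q_C p l \<mu> s y"
proof -
  define u where "u = (frob p l ^^ n) x"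
  have "tr p l (\<mu> * u * S u) = tr p l (\<mu> * x * S x)"
    using tr_mult_funpow_frob[OF assms(1), of n "x * S x"]
    by (simp add: u_def S_funpow_frob funpow_frob_hom mult.assoc)
  moreover have "tr p l (\<mu> * (u + y) * S (u + y)) =
      tr p l (\<mu> * u * S u) + tr p l (\<mu> * y * S y) + 2 * tr p l (\<mu> * u * S y)"
    using tr_S_sym[OF assms(2), of u y] by (simp add: S_add distrib_left distrib_right tr_add)
  ultimately show ?thesis
    using two_nonzero by (simp add: Q_C_def u_def[symmetric] field_simps)
qed

end

theorem theorem8p4:
  fixes p l :: nat and s :: "nat \<Rightarrow> 'a::{field, finite}" and \<mu> :: 'a
  assumes "prime p" and "odd p" and "l \<ge> 1"
    and "CARD('a) = p ^ (p * l)"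
    and "\<forall>i<p * l. s i \<in> Fpl p l"
    and "\<mu> \<in> Fpl p l" and "\<mu> \<noteq> 0"
    and "1 < degree (lin_poly p l s)"
    and "real (degree (lin_poly p l s)) < real CARD('a) / real p"
  shows
    "(thompson_subgroup (group_B p l \<mu> s) =
        {elem_B p l \<mu> s a b 0 | a b. theta_B p l \<mu> a b 0 = id} \<and>
      card (thompson_subgroup (group_B p l \<mu> s)) = CARD('a) ^ 2) \<and>
     ((\<forall>i\<in>{1..p * l - 1}. \<mu> * s i - s (p * l - i) ^ (p ^ i) * \<mu> ^ (p ^ i) = 0) \<longrightarrow>
      thompson_subgroup (group_C p l \<mu> s) =
        {elem_C p l \<mu> s a b 0 | a b. theta_C p l \<mu> s a b 0 = id} \<and>
      real (card (thompson_subgroup (group_C p l \<mu> s))) = real CARD('a) ^ 2 / real p)"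
proof -
  interpret frob_field p l s
    using assms by unfold_locales
  have p0: "p > 0"
    using p_ge_3 by simp
  have deg: "p * degree (lin_poly p l s) < CARD('a)"
  proof -
    have "real (p * degree (lin_poly p l s)) < real CARD('a)"
      using assms(9) p0 by (simp add: field_simps)
    then show ?thesis
      by linarith
  qed

  \<comment> \<open>At \<open>c = 0\<close> this exponent is 0 for every \<open>b\<close>, so
    \<open>J\<close> has order \<open>q^2\<close>.\<close>
  interpret B: frob_group p l s "\<lambda>b c. tr p l (\<mu> * c)"
  proof unfold_locales
    show "tr p l (\<mu> * ((frob p l ^^ n) c1 + c2)) = tr p l (\<mu> * c1) + tr p l (\<mu> * c2)" for n c1 c2
      by (simp add: distrib_left tr_add tr_mult_funpow_frob[OF assms(6)])
    show "CARD('a) \<le> p * card {b::'a. tr p l (\<mu> * 0) = 0}"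
      using p0 by (simp add: tr_0)
  qed (use assms(8) deg tr_in_prime_field in auto)
  have \<theta>_B: "theta_B p l \<mu> = (\<lambda>a b c. frob_pow p l (tr p l (\<mu> * c)))"
    by (intro ext) (simp add: theta_B_def)
  have B: "thompson_subgroup (group_B p l \<mu> s) =
      {elem_B p l \<mu> s a b 0 | a b. theta_B p l \<mu> a b 0 = id}"
    unfolding group_B_def elem_B_def \<theta>_B by (rule B.thompson_subgroup_eq)
  have card_B: "card (thompson_subgroup (group_B p l \<mu> s)) = CARD('a) ^ 2"
    unfolding B unfolding elem_B_def \<theta>_B B.card_J by (simp add: tr_0 power2_eq_square)

  have C: "thompson_subgroup (group_C p l \<mu> s) =
        {elem_C p l \<mu> s a b 0 | a b. theta_C p l \<mu> s a b 0 = id} \<and>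
      real (card (thompson_subgroup (group_C p l \<mu> s))) = real CARD('a) ^ 2 / real p"
    if sym: "\<forall>i\<in>{1..p * l - 1}. \<mu> * s i - s (p * l - i) ^ (p ^ i) * \<mu> ^ (p ^ i) = 0"
  proof -
    define e where "e = (\<lambda>b c. 1 / 2 * Q_C p l \<mu> s c + tr p l (\<mu> * b))"
    have e_0: "e b 0 = tr p l (\<mu> * b)" for b
      by (simp add: e_def Q_C_def tr_0)
    \<comment> \<open>At \<open>c = 0\<close> the exponent is \<open>tr p l (\<mu> * b)\<close>,
      whose kernel has order \<open>q/p\<close>.\<close>
    interpret C: frob_group p l s e
    proof unfold_locales
      \<comment> \<open>This keeps the factor \<open>1 / 2\<close> in the prime field; oddness of
        \<open>p\<close> handles the sign in \<open>Q_C\<close>.\<close>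
      have "(2::'a) ^ p = 2"
        using of_nat_power_p[of 2] by simp
      then show "e b c ^ p = e b c" for b c
        using power_p_add[of "1 / 2 * Q_C p l \<mu> s c" "tr p l (\<mu> * b)" 1] p(2)
        by (simp add: e_def Q_C_def power_divide tr_in_prime_field)
      show "e ((frob p l ^^ n) b1 + b2 + (frob p l ^^ n) c1 * S c2) ((frob p l ^^ n) c1 + c2) =
          e b1 c1 + e b2 c2" for n b1 b2 c1 c2
        using Q_C_add_funpow_frob[OF assms(6) sym, of n c1 c2]
        by (simp add: e_def distrib_left tr_add tr_mult_funpow_frob[OF assms(6)] mult.assoc add_ac)
      show "CARD('a) \<le> p * card {b. e b 0 = 0}"
        by (simp add: e_0 card_tr_kernel[OF assms(7)])
    qed (use assms(8) deg in auto)
    have \<theta>_C: "theta_C p l \<mu> s = (\<lambda>a b c. frob_pow p l (e b c))"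
      by (intro ext) (simp add: theta_C_def e_def)
    have C: "thompson_subgroup (group_C p l \<mu> s) =
        {elem_C p l \<mu> s a b 0 | a b. theta_C p l \<mu> s a b 0 = id}"
      unfolding group_C_def elem_C_def \<theta>_C by (rule C.thompson_subgroup_eq)
    have "p * card (thompson_subgroup (group_C p l \<mu> s)) = CARD('a) ^ 2"
      unfolding C unfolding elem_C_def \<theta>_C C.card_J
      using card_tr_kernel[OF assms(7)] by (simp add: e_0 power2_eq_square mult_ac)
    then have "real p * real (card (thompson_subgroup (group_C p l \<mu> s))) = real CARD('a) ^ 2"
      by (metis of_nat_mult of_nat_power)
    then have "real (card (thompson_subgroup (group_C p l \<mu> s))) = real CARD('a) ^ 2 / real p"
      using p0 by (simp add: field_simps)
    with C show ?thesis
      by blast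
  qed
  show ?thesis
    using B card_B C by blast
qed

end
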